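(* Let $D=(V,E)$ be a finite directed graph with two distinct distinguished vertices $b$ and $r$ such that from every vertex of $D$ there is a directed path to at least one of $b,r$. Then $D$ has a Richman cost function, i.e. there exists a function $R\colon V\to[0,1]$ with $R(b)=0$, $R(r)=1$, and $R(v)=\frac{1}{2}\left(R^+(v)+R^-(v)\right)$ for every $v\in V\setminus\{b,r\}$.
   Context: For $v\in V$, $S(v)=\{w\in V : (v,w)\in E\}$ denotes the set of successors of $v$. For a function $f\colon V\to[0,1]$, put $f^+(v)=\max_{w\in S(v)}f(w)$ and $f^-(v)=\min_{u\in S(v)}f(u)$. (Every vertex other than $b,r$ has at least one successor, by the path assumption.) A Richman cost function of $D$ is a function $R\colon V\to[0,1]$ with $R(b)=0$, $R(r)=1$, and $R(v)=(R^+(v)+R^-(v))/2$ for every $v\in V\setminus\{b,r\}$. *)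

theory Defs
  imports Complex_Main "Graph_Theory.Pair_Digraph"
begin

definition successors :: "'a pair_pre_digraph \<Rightarrow> 'a \<Rightarrow> 'a set" where
  "successors D v = {w \<in> pverts D. (v, w) \<in> parcs D}"

text \<open>
  \<open>max_succ\<close> and \<open>min_succ\<close> are meaningful only when the set of successors is
  finite and nonempty: otherwise \<^const>\<open>Max\<close> and \<^const>\<open>Min\<close> return an unspecified value.
  Lemma \<open>successors_nonempty\<close> below shows that this never matters at the vertices
  where a Richman cost function is constrained to be an average.
\<close>

definition max_succ :: "'a pair_pre_digraph \<Rightarrow> ('a \<Rightarrow> real) \<Rightarrow> 'a \<Rightarrow> real" where
  "max_succ D f v = Max (f ` successors D v)"

definition min_succ :: "'a pair_pre_digraph \<Rightarrow> ('a \<Rightarrow> real) \<Rightarrow> 'a \<Rightarrow> real" where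
  "min_succ D f v = Min (f ` successors D v)"

text \<open>
  A function from the vertex set to the unit interval is represented by a total function
  whose values off the vertex set are irrelevant.
\<close>

definition richman_cost_function ::
    "'a pair_pre_digraph \<Rightarrow> 'a \<Rightarrow> 'a \<Rightarrow> ('a \<Rightarrow> real) \<Rightarrow> bool" where
  "richman_cost_function D b r R \<longleftrightarrow>
     (\<forall>v \<in> pverts D. R v \<in> {0..1}) \<and> R b = 0 \<and> R r = 1 \<and>
     (\<forall>v \<in> pverts D - {b, r}. R v = (max_succ D R v + min_succ D R v) / 2)"

lemma (in pair_fin_digraph) finite_successors: "finite (successors G v)"
  unfolding successors_def by simp

lemma (in pair_fin_digraph) successors_nonempty:
  assumes "apath v p b \<or> apath v p r" "v \<noteq> b" "v \<noteq> r"
  shows "successors G v \<noteq> {}"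
proof (cases p)
  case Nil
  with assms show ?thesis by (auto simp: apath_def awalk_def)
next
  case (Cons e es)
  with assms(1) have "e \<in> parcs G" "fst e = v"
    by (auto simp: apath_def awalk_Cons_iff)
  then show ?thesis
    unfolding successors_def using in_arcsD2[of v "snd e"] by (cases e) auto
qed

end

theory Submission
  imports Defs
begin

text \<open>
  A Richman cost function is a fixed point of the averaging operator that sends \<open>f\<close> to half the
  sum of \<open>f\<^sup>+\<close> and \<open>f\<^sup>-\<close> and overrides the values at \<open>b\<close> and \<open>r\<close> by \<open>0\<close> and \<open>1\<close>. Since
  maximum and minimum over a finite nonempty set are monotone in the function and preserve
  the bounds \<open>0\<close> and \<open>1\<close>, the operator is a monotone self-map of the functions with values
  in the unit interval. These functions form a complete lattice under the pointwise order, so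
  the Knaster--Tarski argument (lemma \<open>unit_interval_fixpoint\<close>) yields a fixed point.
  The paths to \<open>b\<close> or \<open>r\<close> give every other vertex a successor, without which maximum and
  minimum would be unspecified.
\<close>

text \<open>
  The witness is the pointwise supremum \<open>R\<close> of all \<open>f\<close> with \<open>f \<le> T f\<close>. Monotonicity gives
  \<open>f \<le> T f \<le> T R\<close> for each such \<open>f\<close>, hence \<open>R \<le> T R\<close>; applying \<open>T\<close> once more puts \<open>T R\<close> itself
  among these \<open>f\<close>, hence \<open>T R \<le> R\<close>.
\<close>

lemma unit_interval_fixpoint:
  fixes T :: "('a \<Rightarrow> real) \<Rightarrow> 'a \<Rightarrow> real"
  assumes range: "\<And>f v. (\<And>w. f w \<in> {0..1}) \<Longrightarrow> T f v \<in> {0..1}"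
    and mono: "\<And>f g v. (\<And>w. f w \<in> {0..1}) \<Longrightarrow> (\<And>w. g w \<in> {0..1}) \<Longrightarrow>
                 (\<And>w. f w \<le> g w) \<Longrightarrow> T f v \<le> T g v"
  obtains R where "\<And>v. R v \<in> {0..1}" "\<And>v. T R v = R v"
proof -
  define F where "F = {f. \<forall>v. f v \<in> {0..1} \<and> f v \<le> T f v}"
  define R where "R v = (SUP f\<in>F. f v)" for v
  have zero: "(\<lambda>_. 0) \<in> F"
    using range[of "\<lambda>_. 0"] by (auto simp: F_def)
  have upper: "f v \<le> R v" if "f \<in> F" for f v
    unfolding R_def using that by (intro cSUP_upper bdd_aboveI[of _ 1]) (auto simp: F_def)
  have least: "R v \<le> c" if "\<And>f. f \<in> F \<Longrightarrow> f v \<le> c" for v c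
    unfolding R_def using zero that by (intro cSUP_least) auto
  have R01: "R v \<in> {0..1}" for v
    using upper[OF zero, of v] least[of v 1] by (auto simp: F_def)
  have R_le: "R v \<le> T R v" for v
  proof (rule least)
    fix f assume "f \<in> F"
    then have "f v \<le> T f v" and "T f v \<le> T R v"
      using mono[of f R v] R01 upper by (auto simp: F_def)
    then show "f v \<le> T R v" by simp
  qed
  have "T R \<in> F"
    using mono[of R "T R"] range[of R] R01 R_le by (auto simp: F_def)
  then have "T R v = R v" for v
    using upper R_le by (intro antisym)
  with R01 show thesis by (rule that)
qed

context pair_fin_digraph
begin

lemma
  assumes "successors G v \<noteq> {}" "\<And>w. f w \<in> {0..1}"
  shows max_succ_unit: "max_succ G f v \<in> {0..1}"
    and min_succ_unit: "min_succ G f v \<in> {0..1}"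
proof -
  have "max_succ G f v \<in> f ` successors G v" "min_succ G f v \<in> f ` successors G v"
    unfolding max_succ_def min_succ_def
    using assms(1) finite_successors by (auto intro!: Max_in Min_in)
  with assms(2) show "max_succ G f v \<in> {0..1}" "min_succ G f v \<in> {0..1}" by auto
qed

lemma
  assumes "successors G v \<noteq> {}" "\<And>w. f w \<le> g w"
  shows max_succ_mono: "max_succ G f v \<le> max_succ G g v"
    and min_succ_mono: "min_succ G f v \<le> min_succ G g v"
proof -
  show "max_succ G f v \<le> max_succ G g v"
    unfolding max_succ_def using assms finite_successors
    by (auto intro!: Max.boundedI order_trans[OF assms(2)] Max_ge)
  show "min_succ G f v \<le> min_succ G g v"
    unfolding min_succ_def using assms finite_successors
    by (auto intro!: Min.boundedI order_trans[OF _ assms(2)] Min_le)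
qed

lemma richman_cost_function_exists:
  assumes "b \<noteq> r" and succ: "\<And>v. v \<in> pverts G - {b, r} \<Longrightarrow> successors G v \<noteq> {}"
  shows "\<exists>R. richman_cost_function G b r R"
proof -
  \<comment> \<open>The default \<open>0\<close> off the vertex set keeps \<open>T\<close> monotone and bounded on total functions.\<close>
  define T where "T f v =
      (if v = r then 1
       else if v \<in> pverts G - {b} then (max_succ G f v + min_succ G f v) / 2
       else 0)" for f v
  have T_unit: "T f v \<in> {0..1}" if "\<And>w. f w \<in> {0..1}" for f v
    using max_succ_unit[of v f] min_succ_unit[of v f] succ[of v] that
    by (auto simp: T_def)
  have T_mono: "T f v \<le> T g v" if "\<And>w. f w \<le> g w" for f g v
    using max_succ_mono[of v f g] min_succ_mono[of v f g] succ[of v] that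
    by (auto simp: T_def intro: add_mono)
  obtain R where R: "\<And>v. R v \<in> {0..1}" "\<And>v. T R v = R v"
    using unit_interval_fixpoint[of T] T_unit T_mono by blast
  have "R b = 0" "R r = 1"
    using R(2)[of b] R(2)[of r] \<open>b \<noteq> r\<close> by (auto simp: T_def)
  moreover have "R v = (max_succ G R v + min_succ G R v) / 2" if "v \<in> pverts G - {b, r}" for v
    using R(2)[of v] that by (simp add: T_def)
  ultimately have "richman_cost_function G b r R"
    unfolding richman_cost_function_def using R(1) by blast
  then show ?thesis by blast
qed

end

theorem theorem1:
  fixes D :: "'a pair_pre_digraph" and b r :: 'a
  assumes "pair_fin_digraph D"
    and "b \<in> pverts D" and "r \<in> pverts D" and "b \<noteq> r"
    and "\<And>v. v \<in> pverts D \<Longrightarrow>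
           \<exists>p. pre_digraph.apath (with_proj D) v p b \<or> pre_digraph.apath (with_proj D) v p r"
  shows "\<exists>R. richman_cost_function D b r R"
proof -
  interpret pair_fin_digraph D by fact
  have "successors D v \<noteq> {}" if "v \<in> pverts D - {b, r}" for v
    using assms(5)[of v] that successors_nonempty[of v _ b r] by blast
  with \<open>b \<noteq> r\<close> show ?thesis by (rule richman_cost_function_exists)
qed

end
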